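(* Let $G$ be a finitely generated group. The class of effectively closed subshifts on $G$ is closed under finite intersections: if $n\ge 1$ and $X_i\subset A_i^G$ ($1\le i\le n$) are effectively closed subshifts over finite alphabets $A_i$, then, regarding all $X_i$ as subsets of $A^G$ with $A=\bigcup_i A_i$, the intersection $\bigcap_{i=1}^n X_i\subset A^G$ is an effectively closed subshift.
   Context: Let $S\subset G$ be a finite generating set closed under inverses and containing $1_G$; words in $S^*$ represent elements of $G$. For a finite alphabet $A$, $A^G$ has the product topology and left shift action $(\sigma_g x)_h=x_{g^{-1}h}$; a subshift is a closed shift-invariant subset. Put $[a]_g=\{x\in A^G:x_g=a\}$. A pattern coding over $A$ is a finite set $c$ of pairs $(w,a)$ with $w\in S^*$, $a\in A$. For a set $\mathcal C$ of pattern codings, $X_{\mathcal C}=\bigcap_{g\in G,\,c\in\mathcal C}\big(A^G\setminus\bigcap_{(w,a)\in c}[a]_{gw}\big)$. $X\subset A^G$ is effectively closed if $X=X_{\mathcal C}$ for some recursively enumerable set $\mathcal C$ of pattern codings over $A$. *)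

theory Defs
  imports
    "HOL-Algebra.Generated_Groups"
    "HOL-Analysis.Function_Topology"
    "HOL-Library.Nat_Bijection"
begin

section \<open>Recursive functions and recursively enumerable sets\<close>

text \<open>
  Total (general) recursive functions of arity \<open>k\<close>. A \<open>k\<close>-ary function is represented by a function
  on lists of which only the values on lists of length \<open>k\<close> matter; this is what the rule \<open>cong\<close>
  expresses. Minimisation is applied to regular functions only, so all functions are total.
\<close>

inductive recursive :: "nat \<Rightarrow> (nat list \<Rightarrow> nat) \<Rightarrow> bool" where
  zero: "recursive k (\<lambda>xs. 0)"
| succ: "recursive 1 (\<lambda>xs. Suc (xs ! 0))"
| proj: "i < k \<Longrightarrow> recursive k (\<lambda>xs. xs ! i)"
| comp: "recursive (length gs) f \<Longrightarrow> (\<And>g. g \<in> set gs \<Longrightarrow> recursive k g) \<Longrightarrow>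
    recursive k (\<lambda>xs. f (map (\<lambda>g. g xs) gs))"
| prim_rec: "recursive k f \<Longrightarrow> recursive (Suc (Suc k)) g \<Longrightarrow>
    recursive (Suc k) (\<lambda>xs. rec_nat (f (tl xs)) (\<lambda>n r. g (n # r # tl xs)) (hd xs))"
| minimisation: "recursive (Suc k) f \<Longrightarrow> (\<And>xs. length xs = k \<Longrightarrow> \<exists>n. f (n # xs) = 0) \<Longrightarrow>
    recursive k (\<lambda>xs. LEAST n. f (n # xs) = 0)"
| cong: "recursive k f \<Longrightarrow> (\<And>xs. length xs = k \<Longrightarrow> g xs = f xs) \<Longrightarrow> recursive k g"

definition recursively_enumerable :: "nat set \<Rightarrow> bool" where
  "recursively_enumerable N \<longleftrightarrow> N = {} \<or> (\<exists>f. recursive 1 f \<and> N = range (\<lambda>n. f [n]))"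

section \<open>Configurations and subshifts\<close>

text \<open>
  Configurations are extensional functions on the carrier of the group, so that \<open>B \<subseteq> A\<close> literally
  gives \<open>configurations G B \<subseteq> configurations G A\<close>.
\<close>

definition configurations :: "('g, 'b) monoid_scheme \<Rightarrow> 'a set \<Rightarrow> ('g \<Rightarrow> 'a) set" where
  "configurations G A = carrier G \<rightarrow>\<^sub>E A"

definition shift :: "('g, 'b) monoid_scheme \<Rightarrow> 'g \<Rightarrow> ('g \<Rightarrow> 'a) \<Rightarrow> 'g \<Rightarrow> 'a" where
  "shift G g x = (\<lambda>h\<in>carrier G. x (inv\<^bsub>G\<^esub> g \<otimes>\<^bsub>G\<^esub> h))"

definition subshift :: "('g, 'b) monoid_scheme \<Rightarrow> 'a set \<Rightarrow> ('g \<Rightarrow> 'a) set \<Rightarrow> bool" where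
  "subshift G A X \<longleftrightarrow>
    X \<subseteq> configurations G A \<and>
    closedin (product_topology (\<lambda>_. discrete_topology A) (carrier G)) X \<and>
    (\<forall>g\<in>carrier G. shift G g ` X \<subseteq> X)"

definition cylinder :: "('g, 'b) monoid_scheme \<Rightarrow> 'a set \<Rightarrow> 'a \<Rightarrow> 'g \<Rightarrow> ('g \<Rightarrow> 'a) set" where
  "cylinder G A a g = {x \<in> configurations G A. x g = a}"

section \<open>Pattern codings and effectively closed subshifts\<close>

definition symmetric_generating_set :: "('g, 'b) monoid_scheme \<Rightarrow> 'g set \<Rightarrow> bool" where
  "symmetric_generating_set G S \<longleftrightarrow>
    finite S \<and> S \<subseteq> carrier G \<and> generate G S = carrier G \<and>
    \<one>\<^bsub>G\<^esub> \<in> S \<and> (\<forall>s\<in>S. inv\<^bsub>G\<^esub> s \<in> S)"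

definition word_value :: "('g, 'b) monoid_scheme \<Rightarrow> 'g list \<Rightarrow> 'g" where
  "word_value G w = foldr (\<otimes>\<^bsub>G\<^esub>) w \<one>\<^bsub>G\<^esub>"

definition pattern_codings :: "'g set \<Rightarrow> 'a set \<Rightarrow> ('g list \<times> 'a) set set" where
  "pattern_codings S A = {c. finite c \<and> c \<subseteq> lists S \<times> A}"

text \<open>The outer and inner intersections are taken inside \<open>A\<^sup>G\<close>; this matters when \<open>C\<close>, respectively
  \<open>c\<close>, is empty.\<close>

definition avoiding ::
  "('g, 'b) monoid_scheme \<Rightarrow> 'a set \<Rightarrow> ('g list \<times> 'a) set set \<Rightarrow> ('g \<Rightarrow> 'a) set" where
  "avoiding G A C = configurations G A \<inter>
    (\<Inter>g\<in>carrier G. \<Inter>c\<in>C. configurations G A -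
      (configurations G A \<inter> (\<Inter>(w, a)\<in>c. cylinder G A a (g \<otimes>\<^bsub>G\<^esub> word_value G w))))"

text \<open>
  Goedel numbers of pattern codings, relative to numberings \<open>\<nu>\<close> of the generators and \<open>\<mu>\<close> of the
  alphabet; a finite set is coded by its canonical index (binary expansion). Generators and letters
  range over finite sets, so recursive enumerability does not depend on the injective numberings
  chosen.
\<close>

definition coding_number ::
  "('g \<Rightarrow> nat) \<Rightarrow> ('a \<Rightarrow> nat) \<Rightarrow> ('g list \<times> 'a) set \<Rightarrow> nat" where
  "coding_number \<nu> \<mu> c =
    set_encode ((\<lambda>(w, a). prod_encode (list_encode (map \<nu> w), \<mu> a)) ` c)"

definition re_pattern_codings :: "'g set \<Rightarrow> 'a set \<Rightarrow> ('g list \<times> 'a) set set \<Rightarrow> bool" where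
  "re_pattern_codings S A C \<longleftrightarrow>
    C \<subseteq> pattern_codings S A \<and>
    (\<exists>\<nu> \<mu>. inj_on \<nu> S \<and> inj_on \<mu> A \<and> recursively_enumerable (coding_number \<nu> \<mu> ` C))"

definition effectively_closed ::
  "('g, 'b) monoid_scheme \<Rightarrow> 'g set \<Rightarrow> 'a set \<Rightarrow> ('g \<Rightarrow> 'a) set \<Rightarrow> bool" where
  "effectively_closed G S A X \<longleftrightarrow> (\<exists>C. re_pattern_codings S A C \<and> X = avoiding G A C)"

end

theory Submission imports Defs begin

text \<open>
  Let \<open>A\<close> be the union of the alphabets and let \<open>C i\<close> be a recursively enumerable set of pattern
  codings over \<open>A i\<close> that defines \<open>X i\<close>. A configuration over \<open>A\<close> has all its values in \<open>A i\<close> iff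
  it avoids the one-letter patterns \<open>{([], a)}\<close> with \<open>a \<in> A - A i\<close>, since the empty word
  represents the identity and every position is a translate of it. Hence the intersection of the
  \<open>X i\<close> is the set of configurations over \<open>A\<close> that avoid the union of all \<open>C i\<close> together with
  finitely many one-letter patterns (\<open>Inter_avoiding\<close>), and a finite union of recursively enumerable
  sets is recursively enumerable.

  The subtle point is that each \<open>C i\<close> comes with its own numberings of the generators and of the
  letters, whereas the union has to be enumerated with respect to one common choice. So one needs
  that recursive enumerability does not depend on the numberings (\<open>re_coding_numbers\<close>). Two
  injective numberings of a finite set differ by a finite table, and the passage from the one Goedel
  number of a pattern coding to the other applies such tables inside words, pairs and finite sets.
  This is a recursive function (\<open>recursive_recode_set\<close>); here bounded sums do most of the work,
  as they give division, the inverse of the pairing function, and the sum over the binary digits of a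
  number. Words are recoded by a loop that reverses a list while translating it.

  That the intersection is closed in \<open>A\<^sup>G\<close> holds because \<open>A i\<^sup>G\<close> is a closed subspace of
  \<open>A\<^sup>G\<close>.
\<close>

section \<open>Recursive arithmetic\<close>

text \<open>
  Arguments are addressed by \<open>hd\<close> and \<open>tl\<close> instead of by position: passing under a binder of a sum
  or of a recursion then just prepends the bound variables to the argument list.
\<close>

lemma recursive_hd: "recursive (Suc k) (\<lambda>xs. hd xs)"
  by (rule cong[OF proj[of 0 "Suc k"]]) (auto simp: length_Suc_conv)

text \<open>
  Substitution for the first arguments while the remaining ones are passed on. Prepending an
  argument, dropping one and composing in one argument are special cases.
\<close>

lemma recursive_replace_prefix:
  "recursive (m + k) f \<Longrightarrow> length gs = m \<Longrightarrow> (\<And>g. g \<in> set gs \<Longrightarrow> recursive (l + k) g) \<Longrightarrow>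
    recursive (l + k) (\<lambda>ys. f (map (\<lambda>g. g ys) gs @ drop l ys))"
  apply (rule cong[OF comp[of "gs @ map (\<lambda>i ys. ys ! (l + i)) [0..<k]"]])
    apply simp
   apply (auto intro: proj)[1]
  apply (rule arg_cong[where f = f])
  apply (auto intro!: nth_equalityI simp: nth_append)
  done

lemma recursive_tl:
  assumes "recursive k f"
  shows "recursive (Suc k) (\<lambda>xs. f (tl xs))"
  using recursive_replace_prefix[of 0 k f "[]" 1] assms by (simp add: drop_Suc)

lemma recursive_hd_tl: "recursive (Suc (Suc k)) (\<lambda>xs. hd (tl xs))"
  by (intro recursive_tl recursive_hd)

lemma recursive_hd_tl_tl: "recursive (Suc (Suc (Suc k))) (\<lambda>xs. hd (tl (tl xs)))"
  by (intro recursive_tl[of _ "\<lambda>xs. hd (tl xs)"] recursive_hd_tl)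

lemma recursive_app:
  assumes "recursive (Suc 0) f" and "recursive k g"
  shows "recursive k (\<lambda>xs. f [g xs])"
  using comp[of "[g]" f k] assms by simp

lemma recursive_app2:
  assumes "recursive (Suc (Suc 0)) (\<lambda>xs. f (hd xs) (hd (tl xs)))"
    and "recursive k g" and "recursive k h"
  shows "recursive k (\<lambda>xs. f (g xs) (h xs))"
  using comp[of "[g, h]" "\<lambda>xs. f (hd xs) (hd (tl xs))" k] assms by auto

lemma recursive_rec_nat:
  assumes "recursive (Suc (Suc k)) (\<lambda>ys. F (hd ys) (hd (tl ys)) (tl (tl ys)))"
    and "recursive k b" and n: "recursive k n"
  shows "recursive k (\<lambda>xs. rec_nat (b xs) (\<lambda>i r. F i r xs) (n xs))"
  using recursive_replace_prefix[of 1 k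
      "\<lambda>xs. rec_nat (b (tl xs)) (\<lambda>i r. F i r (tl xs)) (hd xs)" "[n]" 0]
    prim_rec[OF assms(2,1)] n by simp

lemma recursive_Suc: "recursive k f \<Longrightarrow> recursive k (\<lambda>xs. Suc (f xs))"
  using recursive_app[of "\<lambda>xs. Suc (xs ! 0)" k f] succ by simp

lemma recursive_const: "recursive k (\<lambda>xs. c)"
  by (induction c) (auto intro: zero recursive_Suc)

lemma recursive_add:
  assumes "recursive k f" and "recursive k g"
  shows "recursive k (\<lambda>xs. f xs + g xs)"
proof -
  have "rec_nat a (\<lambda>i r. Suc r) b = a + b" for a b by (induction b) auto
  moreover have "recursive k (\<lambda>xs. rec_nat (f xs) (\<lambda>i r. Suc r) (g xs))"
    by (rule recursive_rec_nat) (intro recursive_Suc recursive_hd_tl assms)+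
  ultimately show ?thesis by simp
qed

lemma recursive_sum:
  assumes f: "recursive (Suc k) (\<lambda>ys. f (hd ys) (tl ys))" and n: "recursive k n"
  shows "recursive k (\<lambda>xs. \<Sum>i<n xs. f i xs)"
proof -
  have "rec_nat 0 (\<lambda>i r. r + h i) m = (\<Sum>i<m. h i)" for h :: "nat \<Rightarrow> nat" and m
    by (induction m) auto
  moreover have "recursive (Suc (Suc k)) (\<lambda>ys. f (hd ys) (tl (tl ys)))"
    using recursive_replace_prefix[of 1 k "\<lambda>ys. f (hd ys) (tl ys)" "[\<lambda>ys. hd ys]" 2] f
    by (simp add: recursive_hd drop_Suc eval_nat_numeral)
  then have "recursive k (\<lambda>xs. rec_nat 0 (\<lambda>i r. r + f i xs) (n xs))"
    by (intro recursive_rec_nat recursive_add recursive_hd_tl zero n)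
  ultimately show ?thesis by simp
qed

lemma recursive_mult:
  assumes "recursive k f" and "recursive k g"
  shows "recursive k (\<lambda>xs. f xs * g xs)"
  using recursive_sum[OF recursive_tl[OF assms(2)] assms(1)] by simp

lemma recursive_diff:
  assumes "recursive k f" and "recursive k g"
  shows "recursive k (\<lambda>xs. f xs - g xs)"
proof -
  have pred: "rec_nat 0 (\<lambda>i r. i) n = n - 1" for n by (cases n) auto
  have "rec_nat a (\<lambda>i r. rec_nat 0 (\<lambda>i r. i) r) b = a - b" for a b
    by (induction b) (auto simp: pred)
  moreover have "recursive k (\<lambda>xs. rec_nat (f xs) (\<lambda>i r. rec_nat 0 (\<lambda>i r. i) r) (g xs))"
    by (rule recursive_rec_nat; (rule recursive_rec_nat)?)
      (intro recursive_hd recursive_hd_tl zero assms)+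
  ultimately show ?thesis by simp
qed

lemma recursive_power:
  assumes "recursive k f"
  shows "recursive k (\<lambda>xs. c ^ f xs)"
proof -
  have "rec_nat 1 (\<lambda>i r. c * r) n = c ^ n" for n by (induction n) auto
  moreover have "recursive k (\<lambda>xs. rec_nat 1 (\<lambda>i r. c * r) (f xs))"
    by (rule recursive_rec_nat) (intro recursive_mult recursive_const recursive_hd_tl assms)+
  ultimately show ?thesis by simp
qed

text \<open>Relations are handled through their \<open>0\<close>-\<open>1\<close>-valued characteristic functions.\<close>

lemma recursive_le:
  assumes "recursive k f" and "recursive k g"
  shows "recursive k (\<lambda>xs. of_bool (f xs \<le> g xs))"
proof -
  have "of_bool (a \<le> b) = 1 - (a - b)" for a b :: nat by auto
  then show ?thesis by (simp only:) (intro recursive_diff recursive_const assms)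
qed

lemma recursive_eq:
  assumes "recursive k f" and "recursive k g"
  shows "recursive k (\<lambda>xs. of_bool (f xs = g xs))"
proof -
  have "of_bool (a = b) = of_bool (a \<le> b) * (of_bool (b \<le> a) :: nat)" for a b :: nat by auto
  then show ?thesis by (simp only:) (intro recursive_mult recursive_le assms)
qed

lemma recursive_if:
  assumes P: "recursive k (\<lambda>xs. of_bool (P xs))" and "recursive k f" and "recursive k g"
  shows "recursive k (\<lambda>xs. if P xs then f xs else g xs)"
proof (rule cong)
  show "recursive k (\<lambda>xs. of_bool (P xs) * f xs + (1 - of_bool (P xs)) * g xs)"
    by (intro recursive_add recursive_mult recursive_diff recursive_const assms)
qed auto

lemma recursive_div:
  assumes "recursive k f" and "recursive k g"
  shows "recursive k (\<lambda>xs. f xs div g xs)"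
proof (rule recursive_app2[OF _ assms])
  \<comment> \<open>For a positive divisor the quotient counts its positive multiples up to \<open>a\<close>; the factor is
    there because division by \<open>0\<close> gives \<open>0\<close>.\<close>
  have eq: "a div b = of_bool (1 \<le> b) * (\<Sum>q<a. of_bool (Suc q * b \<le> a))" for a b :: nat
  proof (cases "b = 0")
    case False
    then have "Suc q * b \<le> a \<longleftrightarrow> q < a div b" for q
      using less_eq_div_iff_mult_less_eq[of b "Suc q" a] by auto
    moreover have "{..<a} \<inter> {q. q < a div b} = {..<a div b}"
      by (auto intro: less_le_trans[OF _ div_le_dividend])
    ultimately show ?thesis
      using False by (simp add: of_bool_def sum.If_cases del: mult_Suc)
  qed simp
  show "recursive (Suc (Suc 0)) (\<lambda>xs. hd xs div hd (tl xs))"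
    unfolding eq
    by (intro recursive_mult recursive_sum recursive_le recursive_Suc recursive_const
        recursive_hd recursive_hd_tl recursive_hd_tl_tl)
qed

lemma recursive_odd:
  assumes "recursive k f"
  shows "recursive k (\<lambda>xs. of_bool (odd (f xs)))"
proof -
  have "of_bool (odd a) = a - 2 * (a div 2)" for a :: nat
    by (metis minus_mult_div_eq_mod mod2_eq_if of_bool_def)
  then show ?thesis
    by (simp only:) (intro recursive_mult recursive_div recursive_diff recursive_const assms)
qed

lemma recursive_finite_table:
  assumes "finite T"
  shows "recursive (Suc 0) (\<lambda>xs. if hd xs \<in> T then p (hd xs) else 0)"
  using assms
proof (induction T rule: finite_induct)
  case empty
  show ?case by (simp add: zero)
next
  case (insert t T)
  have "recursive (Suc 0)
    (\<lambda>xs. if hd xs = t then p t else (if hd xs \<in> T then p (hd xs) else 0))"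
    by (intro recursive_if recursive_eq recursive_hd recursive_const insert.IH)
  then show ?case by (rule cong) auto
qed

section \<open>Recursive manipulation of pairs and lists\<close>

lemma recursive_prod_encode:
  assumes "recursive k f" and "recursive k g"
  shows "recursive k (\<lambda>xs. prod_encode (f xs, g xs))"
  unfolding prod_encode_def triangle_def
  by (simp only: prod.case) (intro recursive_add recursive_div recursive_mult recursive_Suc
      recursive_const assms)

text \<open>
  Both components of a pair are bounded by its code, so they can be found by a bounded search, here
  written as a double sum with one nonzero term.
\<close>

lemma sum_prod_decode:
  fixes h :: "nat \<Rightarrow> nat \<Rightarrow> nat"
  shows "(\<Sum>a<Suc n. \<Sum>b<Suc n. of_bool (prod_encode (a, b) = n) * h a b) =
    h (fst (prod_decode n)) (snd (prod_decode n))"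
proof -
  obtain a b where n: "n = prod_encode (a, b)"
    by (metis prod.collapse prod_decode_inverse)
  have "a < Suc n" "b < Suc n"
    unfolding n by (simp_all add: less_Suc_eq_le le_prod_encode_1 le_prod_encode_2)
  have "(\<Sum>a'<Suc n. \<Sum>b'<Suc n. of_bool (prod_encode (a', b') = n) * h a' b') =
      (\<Sum>p\<in>{..<Suc n} \<times> {..<Suc n}. if p = (a, b) then h a b else 0)"
    unfolding sum.cartesian_product by (rule sum.cong) (auto simp: n)
  also have "\<dots> = h a b"
    using \<open>a < Suc n\<close> \<open>b < Suc n\<close> by (subst sum.delta) auto
  finally show ?thesis by (simp add: n)
qed

lemma recursive_prod_decode:
  assumes "recursive k f"
  shows "recursive k (\<lambda>xs. fst (prod_decode (f xs)))"
    and "recursive k (\<lambda>xs. snd (prod_decode (f xs)))"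
proof -
  have "recursive (Suc 0) (\<lambda>xs. fst (prod_decode (hd xs)))"
    unfolding sum_prod_decode[where h = "\<lambda>a b. a", symmetric]
    by (intro recursive_sum recursive_mult recursive_eq recursive_prod_encode recursive_Suc
        recursive_hd recursive_hd_tl recursive_hd_tl_tl)
  from recursive_app[OF this assms] show "recursive k (\<lambda>xs. fst (prod_decode (f xs)))" by simp
  have "recursive (Suc 0) (\<lambda>xs. snd (prod_decode (hd xs)))"
    unfolding sum_prod_decode[where h = "\<lambda>a b. b", symmetric]
    by (intro recursive_sum recursive_mult recursive_eq recursive_prod_encode recursive_Suc
        recursive_hd recursive_hd_tl recursive_hd_tl_tl)
  from recursive_app[OF this assms] show "recursive k (\<lambda>xs. snd (prod_decode (f xs)))" by simp
qed

text \<open>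
  One step of a loop that moves the entries of a list, translated by \<open>p\<close>, to an accumulator. Its
  state is the code of the pair of the remaining list and the accumulator. The empty list has code
  \<open>0\<close>, and the code of a nonempty list is the successor of that of the pair of its head and tail,
  hence \<open>u\<close> codes this pair.
\<close>

definition rev_map_step :: "(nat \<Rightarrow> nat) \<Rightarrow> nat \<Rightarrow> nat" where
  "rev_map_step p s =
    (if fst (prod_decode s) = 0 then s
     else let u = fst (prod_decode s) - 1
       in prod_encode (snd (prod_decode u),
            Suc (prod_encode (p (fst (prod_decode u)), snd (prod_decode s)))))"

lemma rev_map_step_iterate:
  assumes "length xs \<le> m"
  shows "rec_nat (prod_encode (list_encode xs, list_encode ys)) (\<lambda>_. rev_map_step p) m =
    prod_encode (0, list_encode (rev (map p xs) @ ys))"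
proof -
  let ?loop = "\<lambda>s. rec_nat s (\<lambda>_. rev_map_step p)"
  \<comment> \<open>The recursor unfolds the last iteration, whereas induction on the list needs the first one.\<close>
  have Suc_iterate: "?loop s (Suc m) = ?loop (rev_map_step p s) m" for s m
    by (induction m) auto
  have step_Nil: "rev_map_step p (prod_encode (list_encode [], a)) = prod_encode (list_encode [], a)"
    for a
    by (simp add: rev_map_step_def)
  have step_Cons: "rev_map_step p (prod_encode (list_encode (x # xs), list_encode ys)) =
      prod_encode (list_encode xs, list_encode (p x # ys))" for x xs ys
    by (simp add: rev_map_step_def)
  from assms show ?thesis
  proof (induction m arbitrary: xs ys)
    case (Suc m)
    show ?case
    proof (cases xs)
      case Nil
      then show ?thesis
        unfolding Suc_iterate using Suc.IH[of xs ys] step_Nil by simp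
    next
      case (Cons x zs)
      then show ?thesis
        unfolding Suc_iterate Cons step_Cons using Suc.IH[of zs "p x # ys"] Suc.prems Cons by simp
    qed
  qed simp
qed

text \<open>
  By this bound the code of a list can serve as the number of iterations of the loop, and the length
  need not be computed.
\<close>

lemma length_le_list_encode: "length xs \<le> list_encode xs"
proof (induction xs)
  case (Cons x xs)
  then show ?case using le_prod_encode_2[of "list_encode xs" x] by simp
qed simp

lemma recursive_rev_map:
  assumes p: "recursive (Suc 0) (\<lambda>xs. p (hd xs))" and f: "recursive k f"
  shows "recursive k (\<lambda>xs. list_encode (rev (map p (list_decode (f xs)))))"
proof -
  have eq: "list_encode (rev (map p (list_decode n))) =
      snd (prod_decode (rec_nat (prod_encode (n, 0)) (\<lambda>_. rev_map_step p) n))" for n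
    using rev_map_step_iterate[OF length_le_list_encode, of "list_decode n" "[]" p] by simp
  have p': "recursive l (\<lambda>xs. p (g xs))" if "recursive l g" for l g
    using recursive_app[OF p that] by simp
  show ?thesis
    unfolding eq rev_map_step_def Let_def
    by (intro recursive_prod_decode recursive_rec_nat recursive_if recursive_eq
        recursive_prod_encode recursive_Suc recursive_diff recursive_const recursive_hd_tl p' f)
qed

lemma recursive_map:
  assumes p: "recursive (Suc 0) (\<lambda>xs. p (hd xs))" and f: "recursive k f"
  shows "recursive k (\<lambda>xs. list_encode (map p (list_decode (f xs))))"
  using recursive_rev_map[of "\<lambda>x. x", OF recursive_hd recursive_rev_map[OF assms]]
  by simp

section \<open>Recursively enumerable sets\<close>

lemma recursively_enumerable_Un:
  assumes "recursively_enumerable M" and "recursively_enumerable N"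
  shows "recursively_enumerable (M \<union> N)"
proof (cases "M = {} \<or> N = {}")
  case True
  then show ?thesis using assms by auto
next
  case False
  then obtain f g where f: "recursive (Suc 0) f" "M = range (\<lambda>n. f [n])"
    and g: "recursive (Suc 0) g" "N = range (\<lambda>n. g [n])"
    using assms unfolding recursively_enumerable_def One_nat_def by blast
  \<comment> \<open>Enumerate \<open>M\<close> at the odd and \<open>N\<close> at the even numbers.\<close>
  let ?h = "\<lambda>xs. if odd (hd xs) then f [hd xs div 2] else g [hd xs div 2]"
  have "recursive 1 ?h"
    by (simp only: One_nat_def)
      (intro recursive_if recursive_odd recursive_app[OF f(1)] recursive_app[OF g(1)]
        recursive_div recursive_hd recursive_const)
  moreover have "M \<union> N = range (\<lambda>n. ?h [n])"
  proof
    have "f [n] = ?h [Suc (2 * n)]" "g [n] = ?h [2 * n]" for n by auto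
    then show "M \<union> N \<subseteq> range (\<lambda>n. ?h [n])" unfolding f g by blast
  qed (auto simp: f g)
  ultimately show ?thesis unfolding recursively_enumerable_def by blast
qed

lemma recursively_enumerable_singleton: "recursively_enumerable {c}"
  unfolding recursively_enumerable_def using recursive_const[of 1 c] by auto

lemma recursively_enumerable_UN:
  assumes "finite I" and "\<And>i. i \<in> I \<Longrightarrow> recursively_enumerable (N i)"
  shows "recursively_enumerable (\<Union>i\<in>I. N i)"
  using assms
proof (induction I rule: finite_induct)
  case empty
  show ?case by (simp add: recursively_enumerable_def)
qed (simp add: recursively_enumerable_Un)

lemma recursively_enumerable_finite: "finite N \<Longrightarrow> recursively_enumerable N"
  using recursively_enumerable_UN[of N "\<lambda>c. {c}"] recursively_enumerable_singleton by simp

lemma recursively_enumerable_image: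
  assumes N: "recursively_enumerable N" and h: "recursive (Suc 0) (\<lambda>xs. h (hd xs))"
  shows "recursively_enumerable (h ` N)"
proof (cases "N = {}")
  case False
  then obtain f where f: "recursive (Suc 0) f" and "N = range (\<lambda>n. f [n])"
    using N unfolding recursively_enumerable_def One_nat_def by blast
  then have "h ` N = range (\<lambda>n. h (f [n]))" by auto
  moreover have "recursive 1 (\<lambda>xs. h (f xs))"
    using recursive_app[OF h f] by simp
  ultimately show ?thesis unfolding recursively_enumerable_def by blast
qed (simp add: recursively_enumerable_def)

section \<open>Independence of the numberings\<close>

definition recode_entry :: "(nat \<Rightarrow> nat) \<Rightarrow> (nat \<Rightarrow> nat) \<Rightarrow> nat \<Rightarrow> nat" where
  "recode_entry p q m = prod_encode
    (list_encode (map p (list_decode (fst (prod_decode m)))), q (snd (prod_decode m)))"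

text \<open>
  The elements of the set with canonical index \<open>N\<close> are the positions of the digits \<open>1\<close> of \<open>N\<close>, and
  all of them are smaller than \<open>N\<close>. If \<open>h\<close> is injective on this set then the sum is the canonical
  index of its image under \<open>h\<close>.
\<close>

definition recode_set :: "(nat \<Rightarrow> nat) \<Rightarrow> nat \<Rightarrow> nat" where
  "recode_set h N = (\<Sum>m<N. of_bool (odd (N div 2 ^ m)) * 2 ^ h m)"

lemma recode_set_set_encode:
  assumes "finite T" and inj: "inj_on h T"
  shows "recode_set h (set_encode T) = set_encode (h ` T)"
proof -
  let ?N = "set_encode T"
  have T: "odd (?N div 2 ^ m) \<longleftrightarrow> m \<in> T" for m
    using set_encode_inverse[OF \<open>finite T\<close>] by (auto simp: set_decode_def)
  have "m < ?N" if "m \<in> T" for m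
  proof -
    have "m < 2 ^ m" by (rule less_exp)
    also have "\<dots> \<le> ?N"
      unfolding set_encode_def using that \<open>finite T\<close> by (intro member_le_sum) auto
    finally show ?thesis .
  qed
  then have "{..<?N} \<inter> T = T" by blast
  have "recode_set h ?N = (\<Sum>m<?N. if m \<in> T then 2 ^ h m else 0)"
    unfolding recode_set_def T by (rule sum.cong) auto
  also have "\<dots> = (\<Sum>m\<in>T. 2 ^ h m)"
    using \<open>{..<?N} \<inter> T = T\<close> by (simp add: sum.inter_restrict[symmetric])
  also have "\<dots> = set_encode (h ` T)"
    unfolding set_encode_def using inj by (simp add: sum.reindex)
  finally show ?thesis .
qed

lemma recursive_recode_set:
  assumes p: "recursive (Suc 0) (\<lambda>xs. p (hd xs))" and q: "recursive (Suc 0) (\<lambda>xs. q (hd xs))"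
  shows "recursive (Suc 0) (\<lambda>xs. recode_set (recode_entry p q) (hd xs))"
proof -
  have q': "recursive l (\<lambda>xs. q (g xs))" if "recursive l g" for l g
    using recursive_app[OF q that] by simp
  show ?thesis
    unfolding recode_set_def recode_entry_def
    by (intro recursive_sum recursive_mult recursive_odd recursive_div recursive_power
        recursive_prod_encode recursive_map recursive_prod_decode recursive_const
        recursive_hd recursive_hd_tl p q')
qed

text \<open>
  The new numberings have to be injective so that different entries of \<open>c\<close> keep different codes:
  otherwise a power of \<open>2\<close> would be counted twice and the sum would not be the canonical index of
  the recoded set.
\<close>

lemma recode_coding_number:
  assumes c: "c \<in> pattern_codings S B"
    and inj: "inj_on \<nu>' S" "inj_on \<mu>' B"
    and p: "\<And>s. s \<in> S \<Longrightarrow> p (\<nu> s) = \<nu>' s" and q: "\<And>a. a \<in> B \<Longrightarrow> q (\<mu> a) = \<mu>' a"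
  shows "recode_set (recode_entry p q) (coding_number \<nu> \<mu> c) = coding_number \<nu>' \<mu>' c"
proof -
  let ?e = "\<lambda>(w, a). prod_encode (list_encode (map \<nu> w), \<mu> a)"
  let ?e' = "\<lambda>(w, a). prod_encode (list_encode (map \<nu>' w), \<mu>' a)"
  from c have "finite c" and sub: "c \<subseteq> lists S \<times> B" by (auto simp: pattern_codings_def)
  have e': "recode_entry p q (?e x) = ?e' x" if x: "x \<in> c" for x
  proof -
    obtain w a where xwa: "x = (w, a)" by (cases x)
    then have w: "w \<in> lists S" and "a \<in> B" using sub x by auto
    have map: "map (p \<circ> \<nu>) w = map \<nu>' w" using p w by (intro map_cong) auto
    show ?thesis using q \<open>a \<in> B\<close> by (simp add: recode_entry_def xwa map)
  qed
  have "inj_on ?e' (lists S \<times> B)"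
  proof (rule inj_onI)
    fix x y assume x: "x \<in> lists S \<times> B" and y: "y \<in> lists S \<times> B" and "?e' x = ?e' y"
    then have eq: "map \<nu>' (fst x) = map \<nu>' (fst y)" "\<mu>' (snd x) = \<mu>' (snd y)"
      by (simp_all add: case_prod_beta prod_encode_eq list_encode_eq)
    from x y have *: "fst x \<in> lists S" "fst y \<in> lists S" "snd x \<in> B" "snd y \<in> B"
      by (simp_all add: mem_Times_iff)
    have "fst x = fst y"
      using inj_on_map_lists[OF inj(1)] eq(1) *(1,2) by (rule inj_onD)
    moreover have "snd x = snd y"
      using inj(2) eq(2) *(3,4) by (rule inj_onD)
    ultimately show "x = y" by (rule prod_eqI)
  qed
  then have "inj_on ?e' c" using sub by (rule inj_on_subset)
  moreover have "inj_on (recode_entry p q \<circ> ?e) c \<longleftrightarrow> inj_on ?e' c"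
    by (rule inj_on_cong) (simp only: o_apply e')
  ultimately have "inj_on (recode_entry p q \<circ> ?e) c" by simp
  then have "inj_on (recode_entry p q) (?e ` c)" by (rule inj_on_imageI)
  moreover have "recode_entry p q ` ?e ` c = ?e' ` c"
    unfolding image_image using e' by (rule image_cong[OF refl])
  ultimately show ?thesis
    unfolding coding_number_def using \<open>finite c\<close> by (simp add: recode_set_set_encode)
qed

text \<open>
  Any injective numbering is as good as the ones that witness recursive enumerability, since on a
  finite set the translation between two injective numberings is a finite table.
\<close>

lemma re_coding_numbers:
  assumes re: "re_pattern_codings S B C" and "finite S" and "finite B"
    and inj: "inj_on \<nu>' S" "inj_on \<mu>' B"
  shows "recursively_enumerable (coding_number \<nu>' \<mu>' ` C)"
proof -
  from re obtain \<nu> \<mu> where C: "C \<subseteq> pattern_codings S B"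
    and \<nu>: "inj_on \<nu> S" and \<mu>: "inj_on \<mu> B"
    and enum: "recursively_enumerable (coding_number \<nu> \<mu> ` C)"
    unfolding re_pattern_codings_def by blast
  define p where "p k = (if k \<in> \<nu> ` S then \<nu>' (inv_into S \<nu> k) else 0)" for k
  define q where "q k = (if k \<in> \<mu> ` B then \<mu>' (inv_into B \<mu> k) else 0)" for k
  have "recursive (Suc 0) (\<lambda>xs. p (hd xs))" "recursive (Suc 0) (\<lambda>xs. q (hd xs))"
    unfolding p_def q_def using \<open>finite S\<close> \<open>finite B\<close> by (auto intro!: recursive_finite_table)
  then have "recursively_enumerable (recode_set (recode_entry p q) ` coding_number \<nu> \<mu> ` C)"
    by (intro recursively_enumerable_image enum recursive_recode_set)
  also have "recode_set (recode_entry p q) ` coding_number \<nu> \<mu> ` C = coding_number \<nu>' \<mu>' ` C"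
    unfolding image_image
  proof (rule image_cong[OF refl])
    fix c assume "c \<in> C"
    with C have "c \<in> pattern_codings S B" ..
    then show "recode_set (recode_entry p q) (coding_number \<nu> \<mu> c) = coding_number \<nu>' \<mu>' c"
      by (rule recode_coding_number) (simp_all add: inj p_def q_def \<nu> \<mu>)
  qed
  finally show ?thesis .
qed

section \<open>Intersections of subshifts\<close>

lemma mem_avoiding_iff:
  "x \<in> avoiding G A C \<longleftrightarrow> x \<in> configurations G A \<and>
    (\<forall>g\<in>carrier G. \<forall>c\<in>C. \<exists>(w, a)\<in>c. x (g \<otimes>\<^bsub>G\<^esub> word_value G w) \<noteq> a)"
  unfolding avoiding_def cylinder_def
  by (cases "x \<in> configurations G A") (auto simp: case_prod_beta)

definition letter_patterns :: "'a set \<Rightarrow> ('g list \<times> 'a) set set" where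
  "letter_patterns B = (\<lambda>a. {([], a)}) ` B"

lemma avoids_letter_patterns_iff:
  assumes "group G"
  shows "(\<forall>g\<in>carrier G. \<forall>c\<in>letter_patterns B. \<exists>(w, a)\<in>c. x (g \<otimes>\<^bsub>G\<^esub> word_value G w) \<noteq> a)
    \<longleftrightarrow> (\<forall>g\<in>carrier G. x g \<notin> B)"
proof -
  interpret group G by fact
  show ?thesis by (auto simp: letter_patterns_def word_value_def)
qed

text \<open>
  Besides the patterns of all \<open>C i\<close> one forbids every letter that is missing from one of the
  alphabets. This brings a configuration over the union down to each \<open>A i\<close>, and the condition for a
  single pattern does not refer to the alphabet any more (\<open>mem_avoiding_iff\<close>).
\<close>

lemma Inter_avoiding:
  fixes G :: "('g, 'b) monoid_scheme" and A :: "'i \<Rightarrow> 'a set"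
    and C :: "'i \<Rightarrow> ('g list \<times> 'a) set set"
  assumes "group G" and "I \<noteq> {}"
  shows "(\<Inter>i\<in>I. avoiding G (A i) (C i)) =
    avoiding G (\<Union>i\<in>I. A i) ((\<Union>i\<in>I. C i) \<union> letter_patterns (\<Union>j\<in>I. (\<Union>i\<in>I. A i) - A j))"
    (is "?L = avoiding G ?A ?C")
proof (rule Set.set_eqI)
  fix x
  define avoids where "avoids (D :: ('g list \<times> 'a) set set) \<longleftrightarrow>
    (\<forall>g\<in>carrier G. \<forall>c\<in>D. \<exists>(w, a)\<in>c. x (g \<otimes>\<^bsub>G\<^esub> word_value G w) \<noteq> a)" for D
  have mem: "x \<in> avoiding G B D \<longleftrightarrow> x \<in> configurations G B \<and> avoids D" for B D
    by (simp add: mem_avoiding_iff avoids_def)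
  have avoids_union: "avoids ?C \<longleftrightarrow>
      (\<forall>i\<in>I. avoids (C i)) \<and> avoids (letter_patterns (\<Union>j\<in>I. ?A - A j))"
    unfolding avoids_def by (simp only: ball_Un ball_UN) blast
  have conf: "(\<forall>i\<in>I. x \<in> configurations G (A i)) \<longleftrightarrow>
      x \<in> configurations G ?A \<and> (\<forall>g\<in>carrier G. x g \<notin> (\<Union>j\<in>I. ?A - A j))"
  proof
    assume L: "\<forall>i\<in>I. x \<in> configurations G (A i)"
    moreover obtain i where "i \<in> I" using \<open>I \<noteq> {}\<close> by blast
    ultimately have "x \<in> configurations G ?A"
      unfolding configurations_def PiE_iff by blast
    moreover have "\<forall>g\<in>carrier G. x g \<notin> (\<Union>j\<in>I. ?A - A j)"
      using L unfolding configurations_def PiE_iff by blast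
    ultimately show "x \<in> configurations G ?A \<and> (\<forall>g\<in>carrier G. x g \<notin> (\<Union>j\<in>I. ?A - A j))" ..
  next
    assume R: "x \<in> configurations G ?A \<and> (\<forall>g\<in>carrier G. x g \<notin> (\<Union>j\<in>I. ?A - A j))"
    show "\<forall>i\<in>I. x \<in> configurations G (A i)"
    proof
      fix i assume "i \<in> I"
      then have "x g \<in> A i" if "g \<in> carrier G" for g
        using R that unfolding configurations_def PiE_iff by blast
      then show "x \<in> configurations G (A i)"
        using R unfolding configurations_def PiE_iff by simp
    qed
  qed
  have "x \<in> ?L \<longleftrightarrow> (\<forall>i\<in>I. x \<in> configurations G (A i)) \<and> (\<forall>i\<in>I. avoids (C i))"
    unfolding INT_iff mem by blast
  also have "\<dots> \<longleftrightarrow> x \<in> configurations G ?A \<and> avoids ?C"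
    unfolding conf avoids_union
    using avoids_letter_patterns_iff[OF \<open>group G\<close>, of "\<Union>j\<in>I. ?A - A j" x]
    by (simp only: avoids_def conj_ac)
  finally show "x \<in> ?L \<longleftrightarrow> x \<in> avoiding G ?A ?C"
    unfolding mem .
qed

text \<open>
  The configurations over \<open>B\<close> form a box with closed sides in the space of those
  over \<open>A\<close>, and their own topology is the subspace topology.
\<close>

lemma closedin_configurations_mono:
  assumes "B \<subseteq> A"
    and X: "closedin (product_topology (\<lambda>_. discrete_topology B) (carrier G)) X"
  shows "closedin (product_topology (\<lambda>_. discrete_topology A) (carrier G)) X"
proof -
  let ?T = "product_topology (\<lambda>_. discrete_topology A) (carrier G)"
  have "product_topology (\<lambda>_. discrete_topology B) (carrier G) =
      subtopology ?T (carrier G \<rightarrow>\<^sub>E B)"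
    using \<open>B \<subseteq> A\<close> by (simp add: subtopology_product_topology Int_absorb1)
  moreover have "closedin ?T (carrier G \<rightarrow>\<^sub>E B)"
    using \<open>B \<subseteq> A\<close> by (simp add: closedin_product_topology)
  ultimately show ?thesis using X by (metis closedin_trans_full)
qed

lemma subshift_mono:
  assumes "B \<subseteq> A" and "subshift G B X"
  shows "subshift G A X"
proof -
  have "configurations G B \<subseteq> configurations G A"
    unfolding configurations_def using \<open>B \<subseteq> A\<close> by (intro PiE_mono)
  then show ?thesis
    using assms closedin_configurations_mono[OF \<open>B \<subseteq> A\<close>] by (auto simp: subshift_def)
qed

lemma subshift_INT:
  assumes "I \<noteq> {}" and sub: "\<And>i. i \<in> I \<Longrightarrow> subshift G A (X i)"
  shows "subshift G A (\<Inter>i\<in>I. X i)"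
  unfolding subshift_def
proof (intro conjI ballI)
  obtain i where "i \<in> I" using \<open>I \<noteq> {}\<close> by blast
  then have "(\<Inter>i\<in>I. X i) \<subseteq> X i" by blast
  also have "X i \<subseteq> configurations G A" using sub[OF \<open>i \<in> I\<close>] by (simp add: subshift_def)
  finally show "(\<Inter>i\<in>I. X i) \<subseteq> configurations G A" .
next
  show "closedin (product_topology (\<lambda>_. discrete_topology A) (carrier G)) (\<Inter>i\<in>I. X i)"
    using assms by (intro closedin_INT) (auto simp: subshift_def)
next
  fix g assume "g \<in> carrier G"
  then have "shift G g ` X i \<subseteq> X i" if "i \<in> I" for i
    using sub[OF that] by (simp add: subshift_def)
  then show "shift G g ` (\<Inter>i\<in>I. X i) \<subseteq> (\<Inter>i\<in>I. X i)" by blast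
qed

lemma effectively_closed_INT:
  fixes G :: "('g, 'b) monoid_scheme" and A :: "'i \<Rightarrow> 'a set"
  assumes "group G" and "finite S" and "finite I" and "I \<noteq> {}"
    and fin: "\<And>i. i \<in> I \<Longrightarrow> finite (A i)"
    and eff: "\<And>i. i \<in> I \<Longrightarrow> effectively_closed G S (A i) (X i)"
  shows "effectively_closed G S (\<Union>i\<in>I. A i) (\<Inter>i\<in>I. X i)"
proof -
  let ?A = "\<Union>i\<in>I. A i"
  have "\<forall>i\<in>I. \<exists>C. re_pattern_codings S (A i) C \<and> X i = avoiding G (A i) C"
    using eff unfolding effectively_closed_def by blast
  then obtain C where re: "\<And>i. i \<in> I \<Longrightarrow> re_pattern_codings S (A i) (C i)"
    and X: "\<And>i. i \<in> I \<Longrightarrow> X i = avoiding G (A i) (C i)"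
    by metis
  define L :: "('g list \<times> 'a) set set" where "L = letter_patterns (\<Union>j\<in>I. ?A - A j)"
  have "finite ?A" using \<open>finite I\<close> fin by simp
  then have "finite L" unfolding L_def letter_patterns_def using \<open>finite I\<close> by simp
  obtain \<nu> :: "'g \<Rightarrow> nat" where \<nu>: "inj_on \<nu> S"
    using finite_imp_inj_to_nat_seg[OF \<open>finite S\<close>] by blast
  obtain \<mu> :: "'a \<Rightarrow> nat" where \<mu>: "inj_on \<mu> ?A"
    using finite_imp_inj_to_nat_seg[OF \<open>finite ?A\<close>] by blast
  have "recursively_enumerable (coding_number \<nu> \<mu> ` C i)" if "i \<in> I" for i
  proof (rule re_coding_numbers[OF re[OF that] \<open>finite S\<close> fin[OF that] \<nu>])
    show "inj_on \<mu> (A i)" using \<mu> by (rule inj_on_subset) (use that in blast)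
  qed
  then have "recursively_enumerable ((\<Union>i\<in>I. coding_number \<nu> \<mu> ` C i) \<union> coding_number \<nu> \<mu> ` L)"
    using \<open>finite I\<close> recursively_enumerable_finite[OF finite_imageI[OF \<open>finite L\<close>]]
    by (intro recursively_enumerable_Un recursively_enumerable_UN)
  then have "recursively_enumerable (coding_number \<nu> \<mu> ` ((\<Union>i\<in>I. C i) \<union> L))"
    by (simp add: image_Un image_UN)
  moreover have "(\<Union>i\<in>I. C i) \<subseteq> pattern_codings S ?A"
  proof (rule UN_least)
    fix i assume "i \<in> I"
    then have "C i \<subseteq> pattern_codings S (A i)" using re by (simp add: re_pattern_codings_def)
    also have "\<dots> \<subseteq> pattern_codings S ?A"
      unfolding pattern_codings_def using \<open>i \<in> I\<close> by auto
    finally show "C i \<subseteq> pattern_codings S ?A" .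
  qed
  moreover have "L \<subseteq> pattern_codings S ?A"
    unfolding L_def letter_patterns_def pattern_codings_def by auto
  ultimately have "re_pattern_codings S ?A ((\<Union>i\<in>I. C i) \<union> L)"
    unfolding re_pattern_codings_def using \<nu> \<mu> by (metis Un_least)
  moreover have "(\<Inter>i\<in>I. X i) = avoiding G ?A ((\<Union>i\<in>I. C i) \<union> L)"
    using Inter_avoiding[OF \<open>group G\<close> \<open>I \<noteq> {}\<close>, of A C] X by (simp add: L_def)
  ultimately show ?thesis unfolding effectively_closed_def by blast
qed

theorem proposition2p5:
  fixes G :: "('g, 'b) monoid_scheme" and S :: "'g set"
    and n :: nat and A :: "nat \<Rightarrow> 'a set" and X :: "nat \<Rightarrow> ('g \<Rightarrow> 'a) set"
  assumes "group G" and "symmetric_generating_set G S"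
    and "n \<ge> 1"
    and "\<And>i. i \<in> {1..n} \<Longrightarrow> finite (A i)"
    and "\<And>i. i \<in> {1..n} \<Longrightarrow> subshift G (A i) (X i)"
    and "\<And>i. i \<in> {1..n} \<Longrightarrow> effectively_closed G S (A i) (X i)"
  shows "subshift G (\<Union>i\<in>{1..n}. A i) (\<Inter>i\<in>{1..n}. X i) \<and>
    effectively_closed G S (\<Union>i\<in>{1..n}. A i) (\<Inter>i\<in>{1..n}. X i)"
proof
  have "{1..n} \<noteq> {}" using \<open>n \<ge> 1\<close> by simp
  show "subshift G (\<Union>i\<in>{1..n}. A i) (\<Inter>i\<in>{1..n}. X i)"
  proof (rule subshift_INT[OF \<open>{1..n} \<noteq> {}\<close>])
    fix i assume "i \<in> {1..n}"
    then have "A i \<subseteq> (\<Union>i\<in>{1..n}. A i)" by blast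
    then show "subshift G (\<Union>i\<in>{1..n}. A i) (X i)"
      using assms(5)[OF \<open>i \<in> {1..n}\<close>] by (rule subshift_mono)
  qed
  have "finite S" using assms(2) by (simp add: symmetric_generating_set_def)
  then show "effectively_closed G S (\<Union>i\<in>{1..n}. A i) (\<Inter>i\<in>{1..n}. X i)"
    using \<open>{1..n} \<noteq> {}\<close> assms(4,6) by (intro effectively_closed_INT[OF \<open>group G\<close>]) auto
qed

end
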